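(* We have \[ \begin{split} {\rm(a)}\ & \sum_{n\geq 1} \frac{q^n}{(q^{n+1};q)_\infty (-q^n;q)_\infty^2 (q^3;q^3)_n} = \frac{1}{ (q^3;q^3)_\infty}-\frac{(q;q^2)_\infty}{(q^2;q^2)_\infty}, \\ {\rm(b)}\ & \sum_{n\geq 1} \frac{q^n}{(-q^{n+1};q)_\infty (-q^n;q)_\infty^2 (-q^3;q^3)_n} = \frac{1}{3} \Big( \frac{1}{(-q^3;q^3)_\infty}-\frac{1}{(-q;q)_\infty^3} \Big), \\ {\rm(c)}\ & \sum_{n\geq 1} q^n \frac{(q^{n};q)_\infty (q^3;q^3)_{n-1}}{(-q^{n+1};q)_\infty (-q^3;q^3)_n} = \frac{1}{2}\Big( \frac{(q^3;q^3)_\infty}{(-q^3;q^3)_\infty}-\frac{(q;q)_\infty}{(-q;q)_\infty} \Big), \\ {\rm(d)}\ & \sum_{n\geq 1} q^n \frac{(-q^{n};q)_\infty (-q^3;q^3)_{n-1}}{(q^{n+1};q)_\infty (q^3;q^3)_n} = -\frac{1}{2}\Big( \frac{(-q^3;q^3)_\infty}{(q^3;q^3)_\infty}-\frac{(-q;q)_\infty}{(q;q)_\infty} \Big). \end{split} \]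
   Context: $q$ is a complex number with $|q|<1$. $(a;q)_0=1$, $(a;q)_n=\prod_{j=0}^{n-1}(1-aq^j)$, $(a;q)_\infty=\prod_{j\ge0}(1-aq^j)$. *)

theory Defs
  imports "HOL-Analysis.Analysis"
begin

definition qpoch :: "complex \<Rightarrow> complex \<Rightarrow> nat \<Rightarrow> complex" where
  "qpoch a q n = (\<Prod>j<n. 1 - a * q ^ j)"

definition qpoch_inf :: "complex \<Rightarrow> complex \<Rightarrow> complex" where
  "qpoch_inf a q = (\<Prod>j. 1 - a * q ^ j)"

text \<open>
  For \<open>norm q < 1\<close> the infinite product converges, also when some factor vanishes, so that
  \<^const>\<open>prodinf\<close> does not return an unspecified value; it is the limit of the finite products.
\<close>

lemma has_prod_qpoch_inf:
  assumes "norm q < 1"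
  shows "(\<lambda>j. 1 - a * q ^ j) has_prod qpoch_inf a q"
proof -
  have "summable (\<lambda>j. norm a * norm q ^ j)"
    using assms by (intro summable_mult summable_geometric) simp
  then have "summable (\<lambda>j. norm ((1 - a * q ^ j) - 1))"
    by (simp add: norm_mult norm_power)
  then have "convergent_prod (\<lambda>j. 1 - a * q ^ j)"
    by (intro abs_convergent_prod_imp_convergent_prod summable_imp_abs_convergent_prod)
  then show ?thesis
    unfolding qpoch_inf_def by (rule convergent_prod_has_prod)
qed

lemma qpoch_LIMSEQ_qpoch_inf:
  assumes "norm q < 1"
  shows "(\<lambda>n. qpoch a q n) \<longlonglongrightarrow> qpoch_inf a q"
proof -
  have "(\<lambda>n. \<Prod>j\<le>n. 1 - a * q ^ j) \<longlonglongrightarrow> qpoch_inf a q"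
    using has_prod_qpoch_inf[OF assms, of a] has_prod_imp_tendsto by blast
  then have "(\<lambda>n. qpoch a q (Suc n)) \<longlonglongrightarrow> qpoch_inf a q"
    by (simp add: qpoch_def lessThan_Suc_atMost del: prod.lessThan_Suc)
  then show ?thesis
    by (simp only: filterlim_sequentially_Suc)
qed

end

theory Submission
  imports Defs
begin

text \<open>
  All four series telescope. With \<open>x = q\<^sup>n\<close>, the \<open>n\<close>-th summand is a constant multiple of
  \<open>T n - T (n - 1)\<close>, where \<open>T n\<close> is respectively
  \<open>1 / ((q\<^sup>n\<^sup>+\<^sup>1;q)\<^sub>\<infinity> (-q\<^sup>n\<^sup>+\<^sup>1;q)\<^sub>\<infinity>\<^sup>2 (q\<^sup>3;q\<^sup>3)\<^sub>n)\<close>,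
  \<open>1 / ((-q\<^sup>n\<^sup>+\<^sup>1;q)\<^sub>\<infinity>\<^sup>3 (-q\<^sup>3;q\<^sup>3)\<^sub>n)\<close>,
  \<open>(q\<^sup>n\<^sup>+\<^sup>1;q)\<^sub>\<infinity> (q\<^sup>3;q\<^sup>3)\<^sub>n / ((-q\<^sup>n\<^sup>+\<^sup>1;q)\<^sub>\<infinity> (-q\<^sup>3;q\<^sup>3)\<^sub>n)\<close> and the
  reciprocal of the third; this rests on \<open>(1 + x)\<^sup>2 - (1 + x + x\<^sup>2) = x\<close>,
  \<open>(1 + x)\<^sup>2 - (1 - x + x\<^sup>2) = 3x\<close> and \<open>(1 + x + x\<^sup>2) - (1 - x + x\<^sup>2) = 2x\<close>.
\<close>

lemma qpoch_0 [simp]: "qpoch a q 0 = 1"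
  by (simp add: qpoch_def)

lemma qpoch_Suc: "qpoch a q (Suc n) = qpoch a q n * (1 - a * q ^ n)"
  by (simp add: qpoch_def)

lemma qpoch_add: "qpoch a q (m + n) = qpoch a q m * qpoch (a * q ^ m) q n"
  by (induction n) (simp_all add: qpoch_Suc power_add mult_ac)

text \<open>This is \<open>qpoch_add\<close> with the tail length sent to infinity. The argument
  never divides, so vanishing factors do no harm.\<close>

lemma qpoch_inf_split:
  assumes "norm q < 1"
  shows "qpoch_inf a q = qpoch a q n * qpoch_inf (a * q ^ n) q"
proof (rule LIMSEQ_unique)
  show "(\<lambda>m. qpoch a q (m + n)) \<longlonglongrightarrow> qpoch_inf a q"
    by (rule LIMSEQ_ignore_initial_segment[OF qpoch_LIMSEQ_qpoch_inf[OF assms]])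
  show "(\<lambda>m. qpoch a q (m + n)) \<longlonglongrightarrow> qpoch a q n * qpoch_inf (a * q ^ n) q"
    unfolding add.commute[of _ n] qpoch_add
    by (intro tendsto_mult tendsto_const qpoch_LIMSEQ_qpoch_inf assms)
qed

lemma qpoch_inf_rec:
  assumes "norm q < 1"
  shows "qpoch_inf a q = (1 - a) * qpoch_inf (a * q) q"
  using qpoch_inf_split[OF assms, of a 1] by (simp add: qpoch_def)

lemma one_minus_mult_power_nonzero:
  fixes a q :: complex
  assumes "norm q < 1" "norm a < 1"
  shows "1 - a * q ^ n \<noteq> 0"
proof
  assume "1 - a * q ^ n = 0"
  then have "norm (a * q ^ n) = 1"
    by (metis eq_iff_diff_eq_0 norm_one)
  moreover have "norm (a * q ^ n) \<le> norm a * 1"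
    unfolding norm_mult norm_power using assms
    by (intro mult_left_mono power_le_one) auto
  ultimately show False
    using assms by simp
qed

lemma qpoch_nonzero:
  assumes "norm q < 1" "norm a < 1"
  shows "qpoch a q n \<noteq> 0"
  using one_minus_mult_power_nonzero[OF assms] by (simp add: qpoch_def)

text \<open>A product convergent in the sense of \<open>has_prod\<close> vanishes only if one of its
  factors does, and no factor does here.\<close>

lemma qpoch_inf_nonzero:
  assumes "norm q < 1" "norm a < 1"
  shows "qpoch_inf a q \<noteq> 0"
  unfolding has_prod_eq_0_iff[OF has_prod_qpoch_inf[OF assms(1)]]
  using one_minus_mult_power_nonzero[OF assms] by (simp add: image_iff eq_commute[of 0])

text \<open>The tail is the whole product divided by a partial product, and the whole product is
  nonzero.\<close>

lemma tendsto_qpoch_inf_tail: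
  assumes "norm q < 1" "norm a < 1"
  shows "(\<lambda>n. qpoch_inf (a * q ^ n) q) \<longlonglongrightarrow> 1"
proof -
  have "(\<lambda>n. qpoch_inf a q / qpoch a q n) \<longlonglongrightarrow> qpoch_inf a q / qpoch_inf a q"
    by (intro tendsto_divide tendsto_const qpoch_LIMSEQ_qpoch_inf qpoch_inf_nonzero assms)
  moreover have "qpoch_inf a q / qpoch a q n = qpoch_inf (a * q ^ n) q" for n
    using qpoch_inf_split[OF assms(1), of a n] qpoch_nonzero[OF assms, of n] by simp
  ultimately show ?thesis
    using qpoch_inf_nonzero[OF assms] by simp
qed

text \<open>The first identity is Euler's theorem on partitions into odd and into distinct parts.
  The second pairs \<open>1 - q^j\<close> with \<open>1 + q^j\<close>; splitting
  \<open>(q;q)_(2n)\<close> into odd and even exponents and cancelling \<open>(q;q)_inf\<close> then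
  yields the first.\<close>

lemma qpoch_inf_euler:
  assumes "norm q < 1"
  shows "qpoch_inf q (q ^ 2) * qpoch_inf (- q) q = 1"
    and "qpoch_inf q q * qpoch_inf (- q) q = qpoch_inf (q ^ 2) (q ^ 2)"
proof -
  have q2: "norm (q ^ 2) < 1"
    using assms by (simp add: norm_power power_less_one_iff)
  have "qpoch q q n * qpoch (- q) q n = qpoch (q ^ 2) (q ^ 2) n" for n
    unfolding qpoch_def prod.distrib[symmetric]
    by (intro prod.cong refl) (simp add: power2_eq_square power_mult_distrib algebra_simps)
  then have "(\<lambda>n. qpoch q q n * qpoch (- q) q n) \<longlonglongrightarrow> qpoch_inf (q ^ 2) (q ^ 2)"
    using qpoch_LIMSEQ_qpoch_inf[OF q2] by simp
  moreover have "(\<lambda>n. qpoch q q n * qpoch (- q) q n) \<longlonglongrightarrow> qpoch_inf q q * qpoch_inf (- q) q"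
    by (intro tendsto_mult qpoch_LIMSEQ_qpoch_inf assms)
  ultimately show prod_eq: "qpoch_inf q q * qpoch_inf (- q) q = qpoch_inf (q ^ 2) (q ^ 2)"
    using LIMSEQ_unique by blast
  have "qpoch q (q ^ 2) n * qpoch (q ^ 2) (q ^ 2) n = qpoch q q (2 * n)" for n
    by (induction n) (simp_all add: qpoch_Suc power_mult power_mult_distrib power2_eq_square mult_ac)
  moreover have "(\<lambda>n. qpoch q q (2 * n)) \<longlonglongrightarrow> qpoch_inf q q"
    using LIMSEQ_subseq_LIMSEQ[OF qpoch_LIMSEQ_qpoch_inf[OF assms, of q], of "\<lambda>n. 2 * n"]
    by (simp add: strict_mono_def o_def)
  moreover have "(\<lambda>n. qpoch q (q ^ 2) n * qpoch (q ^ 2) (q ^ 2) n)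
      \<longlonglongrightarrow> qpoch_inf q (q ^ 2) * qpoch_inf (q ^ 2) (q ^ 2)"
    by (intro tendsto_mult qpoch_LIMSEQ_qpoch_inf q2)
  ultimately have "qpoch_inf q (q ^ 2) * qpoch_inf (q ^ 2) (q ^ 2) = qpoch_inf q q"
    using LIMSEQ_unique by simp
  then have "qpoch_inf q q * (qpoch_inf q (q ^ 2) * qpoch_inf (- q) q) = qpoch_inf q q * 1"
    by (simp add: prod_eq[symmetric] mult_ac)
  then show "qpoch_inf q (q ^ 2) * qpoch_inf (- q) q = 1"
    using qpoch_inf_nonzero[OF assms assms] by (metis mult_left_cancel)
qed

text \<open>Over the common denominator \<open>D\<close> the two terms have numerators
  \<open>z ^ 2\<close> and \<open>w\<close>. Here \<open>p\<close>, \<open>m\<close> are tails at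
  \<open>n + 1\<close>, \<open>y * p\<close>, \<open>z * m\<close> the tails at \<open>n\<close>,
  and \<open>y * w\<close> is the new factor of the cubic product \<open>u\<close>.\<close>

lemma telescope_step_cubic_square:
  fixes c x y z w p m u :: "'a::field"
  assumes "p \<noteq> 0" "m \<noteq> 0" "u \<noteq> 0" "y \<noteq> 0" "z \<noteq> 0" "w \<noteq> 0" and x: "c * x = z ^ 2 - w"
  shows "1 / (p * m ^ 2 * (u * (y * w))) - 1 / ((y * p) * (z * m) ^ 2 * u)
    = c * (x * (1 / (p * (z * m) ^ 2 * (u * (y * w)))))"
proof -
  define D where "D = p * (z * m) ^ 2 * (u * (y * w))"
  have "1 / (p * m ^ 2 * (u * (y * w))) = z ^ 2 / D"
    using assms(1-6) by (simp add: D_def frac_eq_eq power_mult_distrib mult_ac)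
  moreover have "1 / ((y * p) * (z * m) ^ 2 * u) = w / D"
    using assms(1-6) by (simp add: D_def frac_eq_eq mult_ac)
  ultimately show ?thesis
    unfolding D_def[symmetric] by (simp add: diff_divide_distrib[symmetric] x[symmetric])
qed

text \<open>Over the common denominator \<open>D\<close> the numerators share the factor
  \<open>y * p * u\<close>, which leaves \<open>w - w'\<close>.\<close>

lemma telescope_step_quotient:
  fixes c x y z w w' p m u v :: "'a::field"
  assumes "m \<noteq> 0" "v \<noteq> 0" "z \<noteq> 0" "w' \<noteq> 0" and x: "c * x = w - w'"
  shows "(p * (u * (y * w))) / (m * (v * (z * w'))) - (y * p * u) / (z * m * v)
    = c * (x * ((y * p * u) / (m * (v * (z * w')))))"
proof -
  define D where "D = m * (v * (z * w'))"
  have "(y * p * u) / (z * m * v) = (y * p * u * w') / D"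
    using assms(1-4) by (simp add: D_def frac_eq_eq mult_ac)
  moreover have "p * (u * (y * w)) - y * p * u * w' = y * p * u * (c * x)"
    unfolding x by (simp add: right_diff_distrib mult_ac)
  ultimately show ?thesis
    unfolding D_def[symmetric] by (simp add: diff_divide_distrib[symmetric] mult_ac)
qed

text \<open>Telescoping gives the value as an ordered series. Convergence of \<open>X\<close> makes
  it bounded, so a geometric series dominates the terms, and absolute convergence upgrades
  \<open>sums\<close> to \<open>has_sum\<close>.\<close>

lemma has_sum_telescope:
  fixes q c :: complex
  assumes "norm q < 1" "c \<noteq> 0" "X \<longlonglongrightarrow> l" "T \<longlonglongrightarrow> L"
    and f: "\<And>n. f (Suc n) = q ^ Suc n * X n"
    and step: "\<And>n. T (Suc n) - T n = c * (q ^ Suc n * X n)"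
  shows "(f has_sum (1 / c * (L - T 0))) {1..}"
proof -
  obtain B where B: "\<And>n. norm (X n) \<le> B"
    using convergent_imp_Bseq[of X] assms(3) by (auto simp: convergent_def Bseq_def)
  have "summable (\<lambda>n. norm (f (Suc n)))"
  proof (rule summable_comparison_test')
    show "summable (\<lambda>n. norm q ^ Suc n * B)"
      using assms(1) by (intro summable_mult2) (simp add: summable_geometric)
    show "norm (norm (f (Suc n))) \<le> norm q ^ Suc n * B" for n
      unfolding f norm_mult norm_power using B[of n] by (simp add: abs_mult mult_left_mono)
  qed
  moreover have "(\<lambda>n. f (Suc n)) sums (1 / c * (L - T 0))"
  proof -
    have "(\<lambda>n. 1 / c * (T (Suc n) - T n)) sums (1 / c * (L - T 0))"
      by (intro sums_mult telescope_sums assms)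
    then show ?thesis
      using \<open>c \<noteq> 0\<close> by (simp only: step f) simp
  qed
  ultimately have "((\<lambda>n. f (Suc n)) has_sum (1 / c * (L - T 0))) UNIV"
    by (rule norm_summable_imp_has_sum)
  then have "(f has_sum (1 / c * (L - T 0))) (range Suc)"
    by (subst has_sum_reindex) (simp_all add: o_def)
  moreover have "range Suc = {1..}"
    by (auto simp: image_iff Suc_le_eq gr0_conv_Suc)
  ultimately show ?thesis
    by simp
qed

theorem theorem2p2:
  fixes q :: complex
  assumes "norm q < 1"
  shows
    "((\<lambda>n::nat. q ^ n /
        (qpoch_inf (q ^ (n + 1)) q * (qpoch_inf (- (q ^ n)) q) ^ 2 * qpoch (q ^ 3) (q ^ 3) n))
      has_sum
        (1 / qpoch_inf (q ^ 3) (q ^ 3) - qpoch_inf q (q ^ 2) / qpoch_inf (q ^ 2) (q ^ 2))) {1..} \<and>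
    ((\<lambda>n::nat. q ^ n /
        (qpoch_inf (- (q ^ (n + 1))) q * (qpoch_inf (- (q ^ n)) q) ^ 2
          * qpoch (- (q ^ 3)) (q ^ 3) n))
      has_sum
        (1 / 3 * (1 / qpoch_inf (- (q ^ 3)) (q ^ 3) - 1 / (qpoch_inf (- q) q) ^ 3))) {1..} \<and>
    ((\<lambda>n::nat. q ^ n *
        ((qpoch_inf (q ^ n) q * qpoch (q ^ 3) (q ^ 3) (n - 1)) /
         (qpoch_inf (- (q ^ (n + 1))) q * qpoch (- (q ^ 3)) (q ^ 3) n)))
      has_sum
        (1 / 2 * (qpoch_inf (q ^ 3) (q ^ 3) / qpoch_inf (- (q ^ 3)) (q ^ 3)
          - qpoch_inf q q / qpoch_inf (- q) q))) {1..} \<and>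
    ((\<lambda>n::nat. q ^ n *
        ((qpoch_inf (- (q ^ n)) q * qpoch (- (q ^ 3)) (q ^ 3) (n - 1)) /
         (qpoch_inf (q ^ (n + 1)) q * qpoch (q ^ 3) (q ^ 3) n)))
      has_sum
        (- (1 / 2) * (qpoch_inf (- (q ^ 3)) (q ^ 3) / qpoch_inf (q ^ 3) (q ^ 3)
          - qpoch_inf (- q) q / qpoch_inf q q))) {1..}"
proof -
  have q3: "norm (q ^ 3) < 1"
    using assms by (simp add: norm_power power_less_one_iff)
  \<comment> \<open>The shift by one makes \<open>P n\<close> and \<open>M n\<close> the tails
    starting at exponent \<open>n + 1\<close>, so the tails starting at \<open>n\<close> in the
    summands become \<open>P\<close> and \<open>M\<close> at \<open>n - 1\<close>.\<close>
  define P where "P n = qpoch_inf (q ^ Suc n) q" for n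
  define M where "M n = qpoch_inf (- (q ^ Suc n)) q" for n
  define U where "U = qpoch (q ^ 3) (q ^ 3)"
  define V where "V = qpoch (- (q ^ 3)) (q ^ 3)"
  define Ui where "Ui = qpoch_inf (q ^ 3) (q ^ 3)"
  define Vi where "Vi = qpoch_inf (- (q ^ 3)) (q ^ 3)"
  have P_lim: "P \<longlonglongrightarrow> 1" and M_lim: "M \<longlonglongrightarrow> 1"
    using tendsto_qpoch_inf_tail[OF assms, of q] tendsto_qpoch_inf_tail[OF assms, of "- q"] assms
    by (simp_all add: P_def[abs_def] M_def[abs_def])
  have U_lim: "U \<longlonglongrightarrow> Ui" and V_lim: "V \<longlonglongrightarrow> Vi"
    unfolding U_def V_def Ui_def Vi_def by (rule qpoch_LIMSEQ_qpoch_inf[OF q3])+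
  have nz: "P n \<noteq> 0" "M n \<noteq> 0" "U n \<noteq> 0" "V n \<noteq> 0" "Ui \<noteq> 0" "Vi \<noteq> 0" for n
  proof -
    have "norm (q ^ Suc n) < 1"
      using assms by (simp add: norm_power power_less_one_iff del: power_Suc)
    then show "P n \<noteq> 0" "M n \<noteq> 0" "U n \<noteq> 0" "V n \<noteq> 0" "Ui \<noteq> 0" "Vi \<noteq> 0"
      unfolding P_def M_def U_def V_def Ui_def Vi_def
      using assms q3 by (simp_all add: qpoch_inf_nonzero qpoch_nonzero del: power_Suc)
  qed
  \<comment> \<open>With \<open>x = q ^ Suc n\<close>, these are the factors in
    \<open>1 - x^3 = y * w\<close> and \<open>1 + x^3 = z * w'\<close>.\<close>
  define y where "y n = 1 - q ^ Suc n" for n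
  define z where "z n = 1 + q ^ Suc n" for n
  define w where "w n = 1 + q ^ Suc n + (q ^ Suc n) ^ 2" for n
  define w' where "w' n = 1 - q ^ Suc n + (q ^ Suc n) ^ 2" for n
  have P_rec: "P n = y n * P (Suc n)"
    and M_rec: "M n = z n * M (Suc n)" for n
    using qpoch_inf_rec[OF assms, of "q ^ Suc n"] qpoch_inf_rec[OF assms, of "- (q ^ Suc n)"]
    by (simp_all add: P_def M_def y_def z_def mult_ac)
  have diffs: "1 * q ^ Suc n = z n ^ 2 - w n" "3 * q ^ Suc n = z n ^ 2 - w' n"
    "2 * q ^ Suc n = w n - w' n" "- 2 * q ^ Suc n = w' n - w n" for n
    unfolding z_def w_def w'_def
    by (simp_all add: power2_sum del: power_Suc)
  have cubes: "1 - x ^ 3 = (1 - x) * (1 + x + x ^ 2)" "1 + x ^ 3 = (1 + x) * (1 - x + x ^ 2)"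
    for x :: complex
    by (simp_all add: power2_eq_square power3_eq_cube algebra_simps)
  have "q ^ 3 * (q ^ 3) ^ n = (q ^ Suc n) ^ 3" for n
    by (simp add: power_mult_distrib power_commutes flip: power_mult) (simp add: mult.commute)
  then have U_rec: "U (Suc n) = U n * (y n * w n)"
    and V_rec: "V (Suc n) = V n * (z n * w' n)" for n
    unfolding y_def z_def w_def w'_def cubes[symmetric]
    by (simp_all add: U_def V_def qpoch_Suc del: power_Suc)
  \<comment> \<open>Each of these divides \<open>U (Suc n)\<close> or \<open>V (Suc n)\<close>, both
    nonzero.\<close>
  have fac: "y n \<noteq> 0" "z n \<noteq> 0" "w n \<noteq> 0" "w' n \<noteq> 0" for n
    using nz(3,4)[of "Suc n"] U_rec[of n] V_rec[of n] by auto
  have a: "((\<lambda>n. q ^ n / (P n * qpoch_inf (- (q ^ n)) q ^ 2 * U n))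
      has_sum (1 / 1 * (1 / Ui - 1 / (P 0 * M 0 ^ 2 * U 0)))) {1..}"
  proof (rule has_sum_telescope[OF assms, where T = "\<lambda>n. 1 / (P n * M n ^ 2 * U n)"])
    \<comment> \<open>The limit stays unsimplified so that its shape matches the limit
      rules.\<close>
    show "(\<lambda>n. 1 / (P (Suc n) * M n ^ 2 * U (Suc n))) \<longlonglongrightarrow> 1 / (1 * 1 ^ 2 * Ui)"
      using nz by (intro tendsto_intros LIMSEQ_Suc P_lim M_lim U_lim) simp
    show "(\<lambda>n. 1 / (P n * M n ^ 2 * U n)) \<longlonglongrightarrow> 1 / Ui"
      using nz by (auto intro!: tendsto_eq_intros P_lim M_lim U_lim)
    show "1 / (P (Suc n) * M (Suc n) ^ 2 * U (Suc n)) - 1 / (P n * M n ^ 2 * U n)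
        = 1 * (q ^ Suc n * (1 / (P (Suc n) * M n ^ 2 * U (Suc n))))" for n
      unfolding P_rec[of n] M_rec[of n] U_rec[of n]
      by (rule telescope_step_cubic_square) (rule nz fac diffs)+
  qed (simp_all add: M_def)
  have b: "((\<lambda>n. q ^ n / (M n * qpoch_inf (- (q ^ n)) q ^ 2 * V n))
      has_sum (1 / 3 * (1 / Vi - 1 / (M 0 * M 0 ^ 2 * V 0)))) {1..}"
  \<comment> \<open>The cube is kept as \<open>M n * M n ^ 2\<close> to fit the step used for (a),
    now with \<open>M\<close> for \<open>P\<close>, \<open>z\<close> for \<open>y\<close> and
    \<open>w'\<close> for \<open>w\<close>.\<close>
  proof (rule has_sum_telescope[OF assms, where T = "\<lambda>n. 1 / (M n * M n ^ 2 * V n)"])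
    show "(\<lambda>n. 1 / (M (Suc n) * M n ^ 2 * V (Suc n))) \<longlonglongrightarrow> 1 / (1 * 1 ^ 2 * Vi)"
      using nz by (intro tendsto_intros LIMSEQ_Suc M_lim V_lim) simp
    show "(\<lambda>n. 1 / (M n * M n ^ 2 * V n)) \<longlonglongrightarrow> 1 / Vi"
      using nz by (auto intro!: tendsto_eq_intros M_lim V_lim)
    show "1 / (M (Suc n) * M (Suc n) ^ 2 * V (Suc n)) - 1 / (M n * M n ^ 2 * V n)
        = 3 * (q ^ Suc n * (1 / (M (Suc n) * M n ^ 2 * V (Suc n))))" for n
      unfolding M_rec[of n] V_rec[of n]
      by (rule telescope_step_cubic_square) (rule nz fac diffs)+
  qed (simp_all add: M_def)
  have c: "((\<lambda>n. q ^ n * ((qpoch_inf (q ^ n) q * U (n - 1)) / (M n * V n)))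
      has_sum (1 / 2 * (Ui / Vi - (P 0 * U 0) / (M 0 * V 0)))) {1..}"
  proof (rule has_sum_telescope[OF assms, where T = "\<lambda>n. (P n * U n) / (M n * V n)"])
    show "(\<lambda>n. (P n * U n) / (M (Suc n) * V (Suc n))) \<longlonglongrightarrow> (1 * Ui) / (1 * Vi)"
      using nz by (intro tendsto_intros LIMSEQ_Suc P_lim M_lim U_lim V_lim) simp
    show "(\<lambda>n. (P n * U n) / (M n * V n)) \<longlonglongrightarrow> Ui / Vi"
      using nz by (auto intro!: tendsto_eq_intros P_lim M_lim U_lim V_lim)
    show "(P (Suc n) * U (Suc n)) / (M (Suc n) * V (Suc n)) - (P n * U n) / (M n * V n)
        = 2 * (q ^ Suc n * ((P n * U n) / (M (Suc n) * V (Suc n))))" for n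
      unfolding P_rec[of n] M_rec[of n] U_rec[of n] V_rec[of n]
      by (rule telescope_step_quotient) (rule nz fac diffs)+
  qed (simp_all add: P_def)
  \<comment> \<open>Compared with \<open>c\<close>, the pairs \<open>P\<close>, \<open>M\<close> and
    \<open>U\<close>, \<open>V\<close> trade places, which turns \<open>w - w'\<close> into
    \<open>w' - w\<close> and the constant 2 into -2.\<close>
  have d: "((\<lambda>n. q ^ n * ((qpoch_inf (- (q ^ n)) q * V (n - 1)) / (P n * U n)))
      has_sum (1 / (- 2) * (Vi / Ui - (M 0 * V 0) / (P 0 * U 0)))) {1..}"
  proof (rule has_sum_telescope[OF assms, where T = "\<lambda>n. (M n * V n) / (P n * U n)"])
    show "(\<lambda>n. (M n * V n) / (P (Suc n) * U (Suc n))) \<longlonglongrightarrow> (1 * Vi) / (1 * Ui)"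
      using nz by (intro tendsto_intros LIMSEQ_Suc P_lim M_lim U_lim V_lim) simp
    show "(\<lambda>n. (M n * V n) / (P n * U n)) \<longlonglongrightarrow> Vi / Ui"
      using nz by (auto intro!: tendsto_eq_intros P_lim M_lim U_lim V_lim)
    show "(M (Suc n) * V (Suc n)) / (P (Suc n) * U (Suc n)) - (M n * V n) / (P n * U n)
        = - 2 * (q ^ Suc n * ((M n * V n) / (P (Suc n) * U (Suc n))))" for n
      unfolding P_rec[of n] M_rec[of n] U_rec[of n] V_rec[of n]
      by (rule telescope_step_quotient) (rule nz fac diffs)+
  qed (simp_all add: M_def)
  \<comment> \<open>Only the boundary term of (a) needs Euler's identities: one factor
    \<open>M 0\<close> is inverted by the first, the other merges with \<open>P 0\<close> by the
    second.\<close>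
  have "1 / (P 0 * M 0 ^ 2 * U 0) = qpoch_inf q (q ^ 2) / qpoch_inf (q ^ 2) (q ^ 2)"
  proof -
    have e: "qpoch_inf q (q ^ 2) * M 0 = 1" "P 0 * M 0 = qpoch_inf (q ^ 2) (q ^ 2)"
      using qpoch_inf_euler[OF assms] by (simp_all add: P_def M_def)
    have "1 / (P 0 * M 0 ^ 2 * U 0) = (1 / M 0) / (P 0 * M 0)"
      by (simp add: U_def power2_eq_square)
    also have "1 / M 0 = qpoch_inf q (q ^ 2)"
      using e(1) nz(2)[of 0] by (simp add: divide_simps)
    finally show ?thesis
      by (simp only: e(2))
  qed
  moreover have "M 0 * M 0 ^ 2 * V 0 = M 0 ^ 3"
    by (simp add: V_def power2_eq_square power3_eq_cube)
  ultimately show ?thesis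
    using a b c d by (simp add: P_def M_def U_def V_def Ui_def Vi_def)
qed

end
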